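(* Let $\mathbb{X}$ be an $m$-dimensional polyhedral Banach space such that $Ext(B_{\mathbb{X}})=\{\pm\widetilde{v_1},\pm\widetilde{v_2},\ldots,\pm\widetilde{v_r}\}$ (with $|Ext(B_{\mathbb{X}})|=2r$), where $\widetilde{v_k}=(v_1^k,v_2^k,\ldots,v_m^k)$, and let $n\in\mathbb{N}$. Then $\mathbb{L}(\mathbb{X},\ell_\infty^n)$ is isometrically isomorphic to an $mn$-dimensional subspace $\mathbb{Y}$ of $\ell_\infty^{rn}$. Moreover, $\mathbb{Y}=\underbrace{\mathbb{W}\oplus_\infty\mathbb{W}\oplus_\infty\cdots\oplus_\infty\mathbb{W}}_{n\text{ times}}$, where $\mathbb{W}=\operatorname{span}\{\widetilde{w_1},\ldots,\widetilde{w_m}\}\subset\ell_\infty^r$ with $\widetilde{w_k}=(v_k^1,v_k^2,\ldots,v_k^r)\in\ell_\infty^r$ for $1\le k\le m$. Therefore, $|Ext(B_{\mathbb{L}(\mathbb{X},\ell_\infty^n)})|=|Ext(B_{\mathbb{W}})|^n$.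
   Context: All spaces are over $\mathbb{R}$; $\ell_\infty^n$ is $\mathbb{R}^n$ with the maximum norm, $\mathbb{L}(\mathbb{X},\mathbb{Y})$ is the space of bounded linear operators with the operator norm, $B_{\mathbb{Z}}$ is the closed unit ball of $\mathbb{Z}$, and $Ext(A)$ is the set of extreme points of a convex set $A$. A finite-dimensional Banach space is polyhedral if its closed unit ball has only finitely many extreme points. $\mathbb{X}$ is identified with $\mathbb{R}^m$ (with some norm) via a fixed basis, and vectors are written in coordinates. $\oplus_\infty$ denotes the $\ell_\infty$-direct sum, with $\|(y_1,y_2)\|=\max\{\|y_1\|,\|y_2\|\}$; the $n$-fold sum of subspaces of $\ell_\infty^r$ is regarded as a subspace of $\ell_\infty^r\oplus_\infty\cdots\oplus_\infty\ell_\infty^r=\ell_\infty^{rn}$. *)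

theory Defs
  imports "HOL-Analysis.Analysis"
begin

text \<open>
  The space \<open>\<ell>\<^sub>\<infinity>\<^sup>n\<close> is the type \<open>'n linf\<close> with \<open>CARD('n) = n\<close>.  A separate type is needed because
  the norm of \<open>real ^ 'n\<close> is the Euclidean one.
\<close>

typedef (overloaded) 'n linf = "UNIV :: ('n::finite \<Rightarrow> real) set"
  morphisms linf_nth Linf
  by simp

setup_lifting type_definition_linf

lemma linf_nth_Linf [simp]: "linf_nth (Linf f) i = f i"
  by (simp add: Linf_inverse)

lemma linf_eqI: "(\<And>i. linf_nth x i = linf_nth y i) \<Longrightarrow> x = y"
  by (simp add: linf_nth_inject[symmetric] ext)

instantiation linf :: (finite) real_vector
begin

lift_definition zero_linf :: "'a linf" is "\<lambda>_. 0" .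
lift_definition plus_linf :: "'a linf \<Rightarrow> 'a linf \<Rightarrow> 'a linf" is "\<lambda>x y i. x i + y i" .
lift_definition minus_linf :: "'a linf \<Rightarrow> 'a linf \<Rightarrow> 'a linf" is "\<lambda>x y i. x i - y i" .
lift_definition uminus_linf :: "'a linf \<Rightarrow> 'a linf" is "\<lambda>x i. - x i" .
lift_definition scaleR_linf :: "real \<Rightarrow> 'a linf \<Rightarrow> 'a linf" is "\<lambda>r x i. r * x i" .

instance
  by standard (transfer; simp add: fun_eq_iff algebra_simps)+

end

lemma linf_nth_simps [simp]:
  "linf_nth 0 i = 0"
  "linf_nth (x + y) i = linf_nth x i + linf_nth y i"
  "linf_nth (x - y) i = linf_nth x i - linf_nth y i"
  "linf_nth (- x) i = - linf_nth x i"
  "linf_nth (r *\<^sub>R x) i = r * linf_nth x i"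
  by (transfer; simp)+

instantiation linf :: (finite) real_normed_vector
begin

definition norm_linf :: "'a linf \<Rightarrow> real"
  where "norm_linf x = Max (range (\<lambda>i. \<bar>linf_nth x i\<bar>))"

definition sgn_linf :: "'a linf \<Rightarrow> 'a linf"
  where "sgn_linf x = x /\<^sub>R norm x"

definition dist_linf :: "'a linf \<Rightarrow> 'a linf \<Rightarrow> real"
  where "dist_linf x y = norm (x - y)"

definition uniformity_linf :: "('a linf \<times> 'a linf) filter"
  where "uniformity_linf = (INF e\<in>{0<..}. principal {(x, y). dist x y < e})"

definition open_linf :: "'a linf set \<Rightarrow> bool"
  where "open_linf U \<longleftrightarrow> (\<forall>x\<in>U. \<forall>\<^sub>F (x', y) in uniformity. x' = x \<longrightarrow> y \<in> U)"

instance
proof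
  have nth_le: "\<bar>linf_nth x i\<bar> \<le> norm x" for x :: "'a linf" and i
    unfolding norm_linf_def by (rule Max_ge) auto
  have norm_le: "norm x \<le> c" if "\<And>i. \<bar>linf_nth x i\<bar> \<le> c" for x :: "'a linf" and c
    unfolding norm_linf_def using that by (subst Max_le_iff) auto
  fix x y :: "'a linf" and r :: real
  show "norm x = 0 \<longleftrightarrow> x = 0"
  proof
    assume "norm x = 0"
    then show "x = 0" using nth_le[of x] by (intro linf_eqI) auto
  next
    assume "x = 0"
    then show "norm x = 0" by (simp add: norm_linf_def)
  qed
  show "norm (x + y) \<le> norm x + norm y"
    using nth_le[of x] nth_le[of y]
    by (intro norm_le) (simp add: abs_triangle_ineq[THEN order_trans] add_mono)
  have le: "norm (s *\<^sub>R z) \<le> \<bar>s\<bar> * norm z" for s and z :: "'a linf"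
    using nth_le[of z] by (intro norm_le) (simp add: abs_mult mult_left_mono)
  show "norm (r *\<^sub>R x) = \<bar>r\<bar> * norm x"
  proof (cases "r = 0")
    case True
    then show ?thesis by (simp add: norm_linf_def)
  next
    case False
    have "norm x \<le> \<bar>inverse r\<bar> * norm (r *\<^sub>R x)"
      using le[of "inverse r" "r *\<^sub>R x"] False by simp
    then have "\<bar>r\<bar> * norm x \<le> norm (r *\<^sub>R x)"
      using False by (simp add: field_simps)
    with le[of r x] show ?thesis by simp
  qed
qed (simp_all add: sgn_linf_def dist_linf_def uniformity_linf_def open_linf_def)

end

definition Ext :: "'a::real_vector set \<Rightarrow> 'a set"
  where "Ext S = {x. x extreme_point_of S}"

definition unit_ball_of :: "'a::real_normed_vector set \<Rightarrow> 'a set"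
  where "unit_ball_of S = {x \<in> S. norm x \<le> 1}"

definition polyhedral_space :: "'a::real_normed_vector itself \<Rightarrow> bool"
  where "polyhedral_space _ \<longleftrightarrow> finite (Ext (unit_ball_of (UNIV :: 'a set)))"

definition isometrically_isomorphic ::
    "'a::real_normed_vector set \<Rightarrow> 'b::real_normed_vector set \<Rightarrow> bool"
  where "isometrically_isomorphic S T \<longleftrightarrow>
    (\<exists>f. linear f \<and> f ` S = T \<and> (\<forall>x\<in>S. norm (f x) = norm x))"

text \<open>
  An element of \<open>\<ell>\<^sub>\<infinity>\<^sup>r\<^sup>n = \<ell>\<^sub>\<infinity>\<^sup>r \<oplus>\<^sub>\<infinity> \<dots> \<oplus>\<^sub>\<infinity> \<ell>\<^sub>\<infinity>\<^sup>r\<close> is indexed by pairs (summand, coordinate), that is, it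
  lives in \<open>('n \<times> 'r) linf\<close>.  The lemma \<open>norm_linf_blocks\<close> below confirms that its norm is the
  maximum of the norms of its \<open>n\<close> components.
\<close>

definition linf_block :: "'n::finite \<Rightarrow> ('n \<times> 'r::finite) linf \<Rightarrow> 'r linf"
  where "linf_block j y = Linf (\<lambda>k. linf_nth y (j, k))"

definition linf_sum :: "('n::finite \<Rightarrow> 'r::finite linf set) \<Rightarrow> ('n \<times> 'r) linf set"
  where "linf_sum W = {y. \<forall>j. linf_block j y \<in> W j}"

lemma norm_linf_blocks:
  fixes y :: "('n::finite \<times> 'r::finite) linf"
  shows "norm y = Max (range (\<lambda>j. norm (linf_block j y)))"
proof (rule antisym)
  have "\<bar>linf_nth y (j, k)\<bar> \<le> Max (range (\<lambda>j. norm (linf_block j y)))" for j k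
  proof -
    have "\<bar>linf_nth y (j, k)\<bar> \<le> norm (linf_block j y)"
      unfolding norm_linf_def linf_block_def by (rule Max_ge) auto
    also have "\<dots> \<le> Max (range (\<lambda>j. norm (linf_block j y)))"
      by (rule Max_ge) auto
    finally show ?thesis .
  qed
  then show "norm y \<le> Max (range (\<lambda>j. norm (linf_block j y)))"
    unfolding norm_linf_def[of y] by (subst Max_le_iff) auto
  show "Max (range (\<lambda>j. norm (linf_block j y))) \<le> norm y"
    unfolding norm_linf_def linf_block_def by (auto intro!: Max_ge)
qed

end

theory Submission
  imports Defs
begin

text \<open>
  The unit ball of the finite-dimensional space \<open>X\<close> is the convex hull of its extreme points
  \<open>\<plusminus> v\<^sub>k\<close>, so a linear map on \<open>X\<close> satisfies \<open>norm T = Max\<^sub>k norm (T v\<^sub>k)\<close>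
  (\<open>norm_le_if_le_on_extreme_points\<close>).  Hence \<open>T \<mapsto> (T v\<^sub>k)\<^sub>k\<close> is an isometry of the operator space
  into \<open>\<ell>\<^sub>\<infinity>\<^sup>r\<^sup>n\<close>.  In the \<open>j\<close>-th block of the image stand the values at the \<open>v\<^sub>k\<close> of the \<open>j\<close>-th
  component functional of \<open>T\<close>.  The components are arbitrary functionals, independent of each other,
  and the value lists \<open>(c\<^sub>k \<bullet> a)\<^sub>k\<close> of functionals with coefficients \<open>a\<close> are exactly the elements of
  \<open>W\<close> (\<open>span_coordinate_functions\<close>), so the image is the \<open>n\<close>-fold sum of \<open>W\<close>
  (\<open>range_eval_rows_at\<close>).  A functional vanishing at all \<open>v\<^sub>k\<close> is zero by the same norm bound; thus
  the \<open>m \<times> n\<close> coefficients are determined by the image, which yields the dimension.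

  For the count, the unit ball of an \<open>\<ell>\<^sub>\<infinity>\<close>-sum is the product of the unit balls of the summands,
  and a point of a product is extreme iff each of its components is (\<open>Ext_linf_sum\<close>).  The number
  for \<open>W\<close> is finite because in coefficients its unit ball is cut out by finitely many half-spaces.
\<close>

section \<open>Equivalence of norms and bounds from extreme points\<close>

text \<open>
  By compactness \<open>norm \<circ> \<phi>\<close> attains a minimum on the Euclidean unit sphere, which is positive.
  This is the equivalence of norms in finite dimension, in the form needed for a codomain with an
  arbitrary norm: it makes pulled-back unit balls bounded and linear maps on the codomain bounded.
\<close>

lemma linear_inj_bounded_below:
  fixes \<phi> :: "'a::euclidean_space \<Rightarrow> 'b::real_normed_vector"
  assumes "linear \<phi>" "inj \<phi>"
  obtains B where "B > 0" "\<And>x. B * norm x \<le> norm (\<phi> x)"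
proof -
  have cont: "continuous_on (sphere 0 1) (\<lambda>x. norm (\<phi> x))"
    using assms(1) by (intro continuous_on_norm linear_continuous_on) (simp add: linear_conv_bounded_linear)
  obtain e :: 'a where "norm e = 1"
    using vector_choose_size[of 1] by auto
  then have "sphere (0::'a) 1 \<noteq> {}" by auto
  then obtain u where u: "norm u = 1" and le: "\<And>x. norm x = 1 \<Longrightarrow> norm (\<phi> u) \<le> norm (\<phi> x)"
    using continuous_attains_inf[OF compact_sphere _ cont] by auto
  show thesis
  proof
    have "\<phi> u \<noteq> 0"
      using assms u linear_injective_0[of \<phi>] by force
    then show "norm (\<phi> u) > 0" by simp
    show "norm (\<phi> u) * norm x \<le> norm (\<phi> x)" for x
    proof (cases "x = 0")
      case False
      then have "norm (\<phi> u) \<le> norm (\<phi> (x /\<^sub>R norm x))"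
        by (intro le) simp
      also have "\<dots> = norm (\<phi> x) / norm x"
        using assms(1) by (simp add: linear_scale divide_inverse)
      finally show ?thesis using False by (simp add: field_simps)
    qed simp
  qed
qed

lemma linear_imp_bounded_linear_if_coordinates:
  fixes \<phi> :: "'a::euclidean_space \<Rightarrow> 'b::real_normed_vector"
    and T :: "'b \<Rightarrow> 'c::real_normed_vector"
  assumes \<phi>: "linear \<phi>" "bij \<phi>" and T: "linear T"
  shows "bounded_linear T"
proof -
  obtain B where B: "B > 0" "\<And>x. B * norm x \<le> norm (\<phi> x)"
    using linear_inj_bounded_below[OF \<phi>(1)] \<phi>(2) by (auto simp: bij_def)
  obtain C where C: "C > 0" "\<And>x. norm ((T \<circ> \<phi>) x) \<le> C * norm x"
    using linear_bounded_pos[OF linear_compose[OF \<phi>(1) T]] by blast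
  have "norm (T x) \<le> norm x * (C / B)" for x
  proof -
    obtain a where a: "x = \<phi> a" using \<phi>(2) by (auto simp: bij_def)
    have "norm (T x) \<le> C * norm a" using C(2)[of a] a by simp
    also have "\<dots> \<le> C * (norm x / B)"
      using B(1) B(2)[of a] C(1) a by (intro mult_left_mono) (simp_all add: field_simps)
    finally show ?thesis by (simp add: mult.commute)
  qed
  then show ?thesis
    using T by (intro bounded_linear_intro[where K = "C / B"]) (auto simp: linear_add linear_scale)
qed

lemma Ext_linear_image:
  assumes f: "linear f" and inj: "inj f"
  shows "Ext (f ` S) = f ` Ext S"
proof -
  have iff: "f x extreme_point_of (f ` S) \<longleftrightarrow> x extreme_point_of S" for x
    using face_of_linear_image[OF f inj, of "{x}" S] by (simp add: face_of_singleton)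
  show ?thesis
  proof (intro set_eqI iffI)
    fix y assume y: "y \<in> Ext (f ` S)"
    then obtain x where "y = f x" by (auto simp: Ext_def extreme_point_of_def)
    with y iff show "y \<in> f ` Ext S" by (auto simp: Ext_def)
  qed (auto simp: Ext_def iff)
qed

text \<open>
  Pulled back to Euclidean coordinates the unit ball is compact and convex, hence the convex hull
  of its extreme points by the theorem of Krein, Milman and Minkowski; a sublevel set of
  \<open>norm \<circ> T\<close> is convex, so it contains the ball as soon as it contains the extreme points.
\<close>

lemma norm_le_if_le_on_extreme_points:
  fixes \<phi> :: "'a::euclidean_space \<Rightarrow> 'b::real_normed_vector"
    and T :: "'b \<Rightarrow> 'c::real_normed_vector"
  assumes \<phi>: "linear \<phi>" "bij \<phi>" and T: "linear T"
    and le: "\<And>e. e \<in> Ext (unit_ball_of UNIV) \<Longrightarrow> norm (T e) \<le> M"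
  shows "norm (T x) \<le> M * norm x"
proof -
  define K where "K = \<phi> -` cball 0 1"
  have inj: "inj \<phi>" and surj: "surj \<phi>" using \<phi>(2) by (auto simp: bij_def)
  have ball: "unit_ball_of (UNIV :: 'b set) = \<phi> ` K"
    unfolding K_def using surj by (auto simp: unit_ball_of_def surj_image_vimage_eq)
  have "convex K"
    unfolding K_def using \<phi>(1) by (intro convex_linear_vimage) auto
  moreover have "compact K"
  proof -
    obtain B where B: "B > 0" "\<And>x. B * norm x \<le> norm (\<phi> x)"
      using linear_inj_bounded_below[OF \<phi>(1) inj] by auto
    have "norm a \<le> 1 / B" if "a \<in> K" for a
      using that B(2)[of a] B(1) by (simp add: K_def field_simps)
    then have "bounded K" by (auto simp: bounded_iff)
    moreover have "closed K"
      unfolding K_def using \<phi>(1)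
      by (intro continuous_closed_vimage closed_cball)
        (simp add: linear_conv_bounded_linear linear_continuous_at)
    ultimately show ?thesis by (simp add: compact_eq_bounded_closed)
  qed
  ultimately have hull: "K = convex hull {a. a extreme_point_of K}"
    by (rule Krein_Milman_Minkowski[rotated])
  have "convex ((T \<circ> \<phi>) -` cball 0 M)"
    using linear_compose[OF \<phi>(1) T] by (intro convex_linear_vimage) auto
  moreover have "{a. a extreme_point_of K} \<subseteq> (T \<circ> \<phi>) -` cball 0 M"
    using le Ext_linear_image[OF \<phi>(1) inj, of K] unfolding ball by (auto simp: Ext_def set_eq_iff)
  ultimately have K: "K \<subseteq> (T \<circ> \<phi>) -` cball 0 M"
    using hull hull_minimal by metis
  have unit: "norm (T z) \<le> M" if "norm z \<le> 1" for z
  proof -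
    have "z \<in> \<phi> ` K" using that unfolding ball[symmetric] by (simp add: unit_ball_of_def)
    then show ?thesis using K by auto
  qed
  show ?thesis
  proof (cases "x = 0")
    case True
    then show ?thesis using T by (simp add: linear_0)
  next
    case False
    then have "norm (T (x /\<^sub>R norm x)) \<le> M" by (intro unit) simp
    then show ?thesis using False T by (simp add: linear_scale field_simps)
  qed
qed

section \<open>Maximum norms and extreme points of \<open>\<ell>\<^sub>\<infinity>\<close>-sums\<close>

lemma norm_linf_le_iff: "norm (x :: 'n::finite linf) \<le> C \<longleftrightarrow> (\<forall>i. \<bar>linf_nth x i\<bar> \<le> C)"
  unfolding norm_linf_def by (subst Max_le_iff) auto

lemma linear_linf_nth: "linear (\<lambda>x. linf_nth x i)"
  by (rule linearI) simp_all

lemma linf_nth_linf_block [simp]: "linf_nth (linf_block j y) k = linf_nth y (j, k)"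
  by (simp add: linf_block_def)

lemma linear_linf_block: "linear (linf_block j)"
  by (rule linearI) (auto intro: linf_eqI)

lemma linf_block_eqI: "(\<And>j. linf_block j x = linf_block j y) \<Longrightarrow> x = y"
proof (rule linf_eqI)
  fix p :: "'a \<times> 'b" assume eq: "\<And>j. linf_block j x = linf_block j y"
  show "linf_nth x p = linf_nth y p"
    using eq[of "fst p"] linf_nth_linf_block[of "fst p" _ "snd p"] by (metis prod.collapse)
qed

lemma unit_ball_of_linf_sum: "unit_ball_of (linf_sum W) = linf_sum (\<lambda>j. unit_ball_of (W j))"
  by (auto simp: unit_ball_of_def linf_sum_def norm_linf_le_iff)

text \<open>
  A segment through \<open>y\<close> projects to a segment in every block, nondegenerate in at least one of them;
  conversely a segment in one block lifts by keeping the other blocks of \<open>y\<close> fixed.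
\<close>

lemma Ext_linf_sum: "Ext (linf_sum S) = linf_sum (\<lambda>j. Ext (S j))"
proof (intro set_eqI iffI)
  fix y assume y: "y \<in> Ext (linf_sum S)"
  then have mem: "linf_block j y \<in> S j" for j
    by (simp add: Ext_def extreme_point_of_def linf_sum_def)
  have "linf_block j y \<notin> open_segment a a'" if a: "a \<in> S j" "a' \<in> S j" for j a a'
  proof
    assume "linf_block j y \<in> open_segment a a'"
    then obtain t where t: "0 < t" "t < 1" and ne: "a \<noteq> a'"
      and eq: "linf_block j y = (1 - t) *\<^sub>R a + t *\<^sub>R a'"
      by (auto simp: in_segment)
    define lift where "lift z = Linf (\<lambda>(i, k). if i = j then linf_nth z k else linf_nth y (i, k))" for z
    have block: "linf_block i (lift z) = (if i = j then z else linf_block i y)" for i z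
      by (rule linf_eqI) (simp add: lift_def)
    have "lift a \<in> linf_sum S" "lift a' \<in> linf_sum S"
      using mem a by (auto simp: linf_sum_def block)
    moreover have "lift a \<noteq> lift a'"
      using ne block[of j a] block[of j a'] by auto
    moreover have "y = (1 - t) *\<^sub>R lift a + t *\<^sub>R lift a'"
    proof (rule linf_block_eqI)
      fix i
      show "linf_block i y = linf_block i ((1 - t) *\<^sub>R lift a + t *\<^sub>R lift a')"
        using eq by (simp add: linear_add[OF linear_linf_block] linear_scale[OF linear_linf_block]
            block flip: scaleR_left_distrib)
    qed
    ultimately show False
      using y t by (auto simp: Ext_def extreme_point_of_def in_segment)
  qed
  with mem show "y \<in> linf_sum (\<lambda>j. Ext (S j))"
    by (simp add: linf_sum_def Ext_def extreme_point_of_def)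
next
  fix y assume y: "y \<in> linf_sum (\<lambda>j. Ext (S j))"
  have "y \<notin> open_segment a a'" if a: "a \<in> linf_sum S" "a' \<in> linf_sum S" for a a'
  proof
    assume "y \<in> open_segment a a'"
    then obtain t where t: "0 < t" "t < 1" and "a \<noteq> a'" and eq: "y = (1 - t) *\<^sub>R a + t *\<^sub>R a'"
      by (auto simp: in_segment)
    then obtain j where "linf_block j a \<noteq> linf_block j a'"
      using linf_block_eqI by blast
    moreover have "linf_block j y = (1 - t) *\<^sub>R linf_block j a + t *\<^sub>R linf_block j a'"
      by (simp add: eq linear_add[OF linear_linf_block] linear_scale[OF linear_linf_block])
    ultimately have "linf_block j y \<in> open_segment (linf_block j a) (linf_block j a')"
      using t by (auto simp: in_segment)
    then show False
      using y a by (auto simp: linf_sum_def Ext_def extreme_point_of_def)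
  qed
  with y show "y \<in> Ext (linf_sum S)"
    by (simp add: linf_sum_def Ext_def extreme_point_of_def)
qed

lemma bij_betw_linf_sum_PiE: "bij_betw (\<lambda>y j. linf_block j y) (linf_sum S) (PiE UNIV S)"
proof (rule bij_betwI[where g = "\<lambda>F. Linf (\<lambda>(j, k). linf_nth (F j) k)"])
  show "(\<lambda>F. Linf (\<lambda>(j, k). linf_nth (F j) k)) \<in> PiE UNIV S \<rightarrow> linf_sum S"
    by (auto simp: linf_sum_def linf_block_def linf_nth_inverse)
qed (auto simp: linf_sum_def linf_block_def linf_nth_inverse intro: linf_eqI)

lemma finite_linf_sum:
  assumes "\<And>j. finite (S j)"
  shows "finite (linf_sum S)"
  using bij_betw_finite[OF bij_betw_linf_sum_PiE, of S] finite_PiE[of UNIV S] assms by simp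

lemma card_linf_sum: "card (linf_sum S) = (\<Prod>j\<in>UNIV. card (S j))"
  using bij_betw_same_card[OF bij_betw_linf_sum_PiE, of S] card_PiE[of UNIV S] by simp

lemma Ext_unit_ball_linear_isometry:
  assumes f: "linear f" and iso: "\<And>x. norm (f x) = norm x"
  shows "Ext (unit_ball_of (range f)) = f ` Ext (unit_ball_of UNIV)"
    and "inj f"
proof -
  show inj: "inj f"
    using linear_injective_0[OF f] iso by (metis norm_eq_zero)
  have ball: "unit_ball_of (range f) = f ` unit_ball_of UNIV"
    using iso by (auto simp: unit_ball_of_def)
  show "Ext (unit_ball_of (range f)) = f ` Ext (unit_ball_of UNIV)"
    by (simp add: ball Ext_linear_image[OF f inj])
qed

section \<open>The subspaces of \<open>\<ell>\<^sub>\<infinity>\<^sup>r\<close> and \<open>\<ell>\<^sub>\<infinity>\<^sup>r\<^sup>n\<close> in coordinates\<close>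

text \<open>
  The vector \<open>a\<close> is the coefficient vector of a linear functional and the \<open>c k\<close> are the coordinates
  of points, so \<open>eval_at c a\<close> lists the values of the functional at these points.  A matrix \<open>A\<close>
  stands for an operator into \<open>\<ell>\<^sub>\<infinity>\<^sup>n\<close>, its row \<open>A $ j\<close> for the \<open>j\<close>-th component functional.
\<close>

definition eval_at :: "('r::finite \<Rightarrow> real ^ 'm::finite) \<Rightarrow> real ^ 'm \<Rightarrow> 'r linf"
  where "eval_at c a = Linf (\<lambda>k. c k \<bullet> a)"

definition eval_rows_at :: "('r::finite \<Rightarrow> real ^ 'm::finite) \<Rightarrow> real ^ 'm ^ 'n::finite \<Rightarrow> ('n \<times> 'r) linf"
  where "eval_rows_at c A = Linf (\<lambda>(j, k). c k \<bullet> A $ j)"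

lemma linf_nth_eval_at [simp]: "linf_nth (eval_at c a) k = c k \<bullet> a"
  by (simp add: eval_at_def)

lemma linear_eval_at: "linear (eval_at c)"
  by (rule linearI) (auto intro: linf_eqI simp: inner_add_right)

lemma linf_block_eval_rows_at: "linf_block j (eval_rows_at c A) = eval_at c (A $ j)"
  by (rule linf_eqI) (simp add: eval_rows_at_def)

lemma linear_eval_rows_at: "linear (eval_rows_at c)"
  by (rule linearI; rule linf_eqI)
    (auto simp: eval_rows_at_def inner_add_right)

lemma inj_eval_rows_at:
  assumes "inj (eval_at c)"
  shows "inj (eval_rows_at c)"
proof (rule injI)
  fix A B assume "eval_rows_at c A = eval_rows_at c B"
  then have "eval_at c (A $ j) = eval_at c (B $ j)" for j
    by (metis linf_block_eval_rows_at)
  then show "A = B" using assms by (simp add: vec_eq_iff inj_eq)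
qed

text \<open>
  The coordinate functionals span all functionals, which is why the vectors \<open>w\<^sub>i\<close> span the space
  of all value lists.
\<close>

lemma span_coordinate_functions:
  "span (range (\<lambda>i. Linf (\<lambda>k. c k $ i))) = range (eval_at c)"
proof -
  have "eval_at c (axis i 1) = Linf (\<lambda>k. c k $ i)" for i
    by (rule linf_eqI) (simp add: inner_axis)
  moreover have Basis: "(Basis :: (real ^ 'b) set) = range (\<lambda>i. axis i 1)"
    by (auto simp: Basis_vec_def)
  ultimately have "eval_at c ` Basis = range (\<lambda>i. Linf (\<lambda>k. c k $ i))"
    unfolding Basis by (simp only: image_image)
  then show ?thesis
    using linear_span_image[OF linear_eval_at, of c Basis] by simp
qed

lemma range_eval_rows_at: "range (eval_rows_at c) = linf_sum (\<lambda>_. range (eval_at c))"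
proof (intro set_eqI iffI)
  fix y assume "y \<in> linf_sum (\<lambda>_. range (eval_at c))"
  then have "\<forall>j. \<exists>a. linf_block j y = eval_at c a" by (auto simp: linf_sum_def)
  then obtain a where a: "\<And>j. linf_block j y = eval_at c (a j)" by metis
  have "y = eval_rows_at c (\<chi> j. a j)"
    by (rule linf_block_eqI) (simp add: a linf_block_eval_rows_at)
  then show "y \<in> range (eval_rows_at c)" by blast
qed (auto simp: linf_sum_def linf_block_eval_rows_at)

lemma dim_range_linear_inj:
  fixes g :: "'a::euclidean_space \<Rightarrow> 'b::real_vector"
  assumes "linear g" "inj g"
  shows "dim (range g) = DIM('a)"
proof -
  have "dim (range g) = card (g ` Basis)"
  proof (rule dim_eq_card)
    show "span (g ` Basis) = span (range g)"
      using linear_span_image[OF assms(1), of Basis]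
      by (simp add: span_linear_image[OF assms(1), of UNIV])
    show "independent (g ` Basis)"
      using assms(2) by (intro linear_independent_injective_image[OF assms(1) independent_Basis])
        (rule inj_on_subset, auto)
  qed
  also have "\<dots> = DIM('a)"
    using assms(2) by (simp add: card_image inj_on_subset)
  finally show ?thesis .
qed

text \<open>
  In coordinates the unit ball is \<open>{a. \<forall>k. \<bar>c k \<bullet> a\<bar> \<le> 1}\<close>, an intersection of finitely many
  half-spaces.
\<close>

lemma finite_Ext_unit_ball_range_eval_at:
  assumes inj: "inj (eval_at c)"
  shows "finite (Ext (unit_ball_of (range (eval_at c))))"
proof -
  define P where "P = (\<Inter>k. {a. c k \<bullet> a \<le> 1} \<inter> {a. (- c k) \<bullet> a \<le> 1})"
  have "polyhedron P"
    unfolding P_def by (intro polyhedron_Inter) (auto intro!: polyhedron_halfspace_le simp del: inner_minus_left)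
  then have "finite {a. a extreme_point_of P}"
    by (rule finite_polyhedron_extreme_points)
  moreover have ball: "unit_ball_of (range (eval_at c)) = eval_at c ` P"
    by (auto simp: unit_ball_of_def norm_linf_le_iff P_def abs_le_iff)
  ultimately show ?thesis
    by (simp add: ball Ext_linear_image[OF linear_eval_at inj]) (simp add: Ext_def)
qed

theorem mainTheorem6:
  fixes b :: "'m::finite \<Rightarrow> 'x::banach"
    and v :: "'r::finite \<Rightarrow> 'x"
    and c :: "'r \<Rightarrow> real ^ 'm"
    and w :: "'m \<Rightarrow> 'r linf"
    and W :: "'r linf set"
  assumes basis: "inj b" "independent (range b)" "span (range b) = UNIV"
    and polyhedral: "polyhedral_space TYPE('x)"
    and ext: "Ext (unit_ball_of (UNIV :: 'x set)) = range v \<union> range (\<lambda>k. - v k)"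
    and card_ext: "card (Ext (unit_ball_of (UNIV :: 'x set))) = 2 * CARD('r)"
    and coordinates: "\<And>k. v k = (\<Sum>i\<in>UNIV. c k $ i *\<^sub>R b i)"
    and w_eq: "\<And>i. w i = Linf (\<lambda>k. c k $ i)"
    and W_eq: "W = span (range w)"
  shows "(\<exists>Y :: ('n::finite \<times> 'r) linf set.
            subspace Y \<and> dim Y = CARD('m) * CARD('n) \<and>
            isometrically_isomorphic (UNIV :: ('x \<Rightarrow>\<^sub>L 'n linf) set) Y \<and>
            Y = linf_sum (\<lambda>_. W)) \<and>
         finite (Ext (unit_ball_of (UNIV :: ('x \<Rightarrow>\<^sub>L 'n linf) set))) \<and>
         finite (Ext (unit_ball_of W)) \<and>
         card (Ext (unit_ball_of (UNIV :: ('x \<Rightarrow>\<^sub>L 'n linf) set))) =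
           card (Ext (unit_ball_of W)) ^ CARD('n)"
proof -
  define \<phi> :: "real ^ 'm \<Rightarrow> 'x" where "\<phi> a = (\<Sum>i\<in>UNIV. a $ i *\<^sub>R b i)" for a
  have \<phi>: "linear \<phi>"
    by (rule linearI) (simp_all add: \<phi>_def scaleR_add_left sum.distrib scaleR_sum_right)
  have \<phi>_axis: "\<phi> (axis i 1) = b i" for i
    by (simp add: \<phi>_def axis_def if_distrib[of "\<lambda>t. t *\<^sub>R _"] cong: if_cong)
  have "inj \<phi>"
  proof (subst linear_injective_0[OF \<phi>], intro allI impI)
    fix a assume "\<phi> a = 0"
    then have "(\<Sum>x\<in>range b. a $ inv b x *\<^sub>R x) = 0"
      by (simp add: \<phi>_def sum.reindex[OF basis(1)] inv_f_f[OF basis(1)])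
    then have "a $ inv b x = 0" if "x \<in> range b" for x
      using that by (intro independentD[OF basis(2)]) auto
    from this[OF rangeI] show "a = 0" by (simp add: vec_eq_iff inv_f_f[OF basis(1)])
  qed
  moreover have "surj \<phi>"
  proof -
    have "range b \<subseteq> range \<phi>" using \<phi>_axis by (metis image_subsetI rangeI)
    then have "span (range b) \<subseteq> range \<phi>"
      using linear_subspace_image[OF \<phi> subspace_UNIV] by (rule span_minimal)
    then show ?thesis using basis(3) by auto
  qed
  ultimately have bij: "bij \<phi>" by (simp add: bij_def)
  define \<psi> where "\<psi> = inv \<phi>"
  have \<psi>\<phi>: "\<psi> (\<phi> a) = a" for a
    using bij by (simp add: \<psi>_def bij_def)
  have \<phi>\<psi>: "\<phi> (\<psi> x) = x" for x
    using bij by (simp add: \<psi>_def bij_def surj_f_inv_f)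
  have \<psi>: "linear \<psi>"
    by (rule linearI) (metis \<phi> \<phi>\<psi> \<psi>\<phi> linear_add, metis \<phi> \<phi>\<psi> \<psi>\<phi> linear_scale)
  have v: "v k = \<phi> (c k)" for k by (simp add: coordinates \<phi>_def)

  \<comment> \<open>Used with \<open>M = 0\<close> for the injectivity of the evaluation and with \<open>M = norm (f T)\<close> for the isometry.\<close>
  have bound: "norm (T x) \<le> M * norm x"
    if "linear T" "\<And>k. norm (T (v k)) \<le> M" for T :: "'x \<Rightarrow> 'z::real_normed_vector" and M x
    using that by (intro norm_le_if_le_on_extreme_points[OF \<phi> bij])
      (auto simp: ext linear_neg)

  have inj_c: "inj (eval_at c)"
  proof (subst linear_injective_0[OF linear_eval_at], intro allI impI)
    fix a assume "eval_at c a = 0"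
    then have a: "c k \<bullet> a = 0" for k by (metis linf_nth_eval_at linf_nth_simps(1))
    have "linear (\<lambda>x. \<psi> x \<bullet> a)"
      by (rule linearI) (simp_all add: linear_add[OF \<psi>] linear_scale[OF \<psi>] inner_add_left)
    then have "norm (\<psi> x \<bullet> a) \<le> 0 * norm x" for x
      by (rule bound) (simp add: v \<psi>\<phi> a)
    from this[of "\<phi> a"] have "a \<bullet> a \<le> 0" by (simp add: \<psi>\<phi>)
    then show "a = 0" by (metis inner_eq_zero_iff inner_ge_zero order_antisym)
  qed
  have W: "W = range (eval_at c)"
    using span_coordinate_functions[of c] by (simp add: W_eq w_eq[abs_def] image_def w_eq)

  define Y :: "('n \<times> 'r) linf set" where "Y = linf_sum (\<lambda>_. W)"
  have Y: "Y = range (eval_rows_at c)"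
    by (simp add: Y_def W range_eval_rows_at)
  have sub: "subspace Y"
    unfolding Y by (rule linear_subspace_image[OF linear_eval_rows_at subspace_UNIV])
  have dim: "dim Y = CARD('m) * CARD('n)"
    unfolding Y by (subst dim_range_linear_inj[OF linear_eval_rows_at inj_eval_rows_at[OF inj_c]]) simp

  define f :: "('x \<Rightarrow>\<^sub>L 'n linf) \<Rightarrow> ('n \<times> 'r) linf"
    where "f T = Linf (\<lambda>(j, k). linf_nth (T (v k)) j)" for T
  have f_nth: "linf_nth (f T) (j, k) = linf_nth (T (v k)) j" for T j k
    by (simp add: f_def)
  have f: "linear f"
    by (rule linearI; rule linf_eqI) (auto simp: f_def blinfun.add_left blinfun.scaleR_left)
  have f_norm: "norm (f T) = norm T" for T
  proof (rule antisym)
    have "v k \<in> Ext (unit_ball_of UNIV)" for k using ext by blast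
    then have v1: "norm (v k) \<le> 1" for k by (simp add: Ext_def extreme_point_of_def unit_ball_of_def)
    have "\<bar>linf_nth (T (v k)) j\<bar> \<le> norm T" for j k
    proof -
      have "\<bar>linf_nth (T (v k)) j\<bar> \<le> norm (T (v k))" using norm_linf_le_iff by blast
      also have "\<dots> \<le> norm T * norm (v k)" by (rule norm_blinfun)
      also have "\<dots> \<le> norm T" using v1[of k] by (simp add: mult_left_le)
      finally show ?thesis .
    qed
    then show "norm (f T) \<le> norm T" by (auto simp: norm_linf_le_iff f_nth)
    have "\<bar>linf_nth (T (v k)) j\<bar> \<le> norm (f T)" for j k
      using norm_linf_le_iff[of "f T" "norm (f T)"] f_nth[of T j k] by (metis order_refl)
    then have "norm (T (v k)) \<le> norm (f T)" for k by (simp add: norm_linf_le_iff)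
    then show "norm T \<le> norm (f T)"
      by (intro norm_blinfun_bound bound) (auto intro: bounded_linear.linear blinfun.bounded_linear_right)
  qed
  have f_range: "range f = Y"
  proof (intro set_eqI iffI)
    fix y assume "y \<in> range f"
    then obtain T where y: "y = f T" by blast
    \<comment> \<open>The coefficients of a functional are its values on the basis.\<close>
    have "y = eval_rows_at c (\<chi> j i. linf_nth (T (b i)) j)"
    proof (rule linf_eqI)
      fix p :: "'n \<times> 'r"
      obtain j k where p: "p = (j, k)" by force
      have "linf_nth (T (v k)) j = (\<Sum>i\<in>UNIV. c k $ i * linf_nth (T (b i)) j)"
        by (simp add: coordinates blinfun.sum_right blinfun.scaleR_right
            linear_sum[OF linear_linf_nth])
      then show "linf_nth y p = linf_nth (eval_rows_at c (\<chi> j i. linf_nth (T (b i)) j)) p"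
        by (simp add: p y f_nth eval_rows_at_def inner_vec_def)
    qed
    then show "y \<in> Y" unfolding Y by blast
  next
    fix y assume "y \<in> Y"
    then obtain A where A: "y = eval_rows_at c A" unfolding Y by blast
    define T where "T x = Linf (\<lambda>j. \<psi> x \<bullet> A $ j)" for x
    have "linear T"
      by (rule linearI; rule linf_eqI)
        (simp_all add: T_def linear_add[OF \<psi>] linear_scale[OF \<psi>] inner_add_left)
    then have "bounded_linear T" by (rule linear_imp_bounded_linear_if_coordinates[OF \<phi> bij])
    then have "y = f (Blinfun T)"
      by (intro linf_eqI) (auto simp: A f_def eval_rows_at_def bounded_linear_Blinfun_apply T_def v \<psi>\<phi>)
    then show "y \<in> range f" by blast
  qed
  have iso: "isometrically_isomorphic (UNIV :: ('x \<Rightarrow>\<^sub>L 'n linf) set) Y"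
    unfolding isometrically_isomorphic_def using f f_norm f_range by blast

  have fin: "finite (Ext (unit_ball_of W))"
    unfolding W by (rule finite_Ext_unit_ball_range_eval_at[OF inj_c])
  have image: "f ` Ext (unit_ball_of UNIV) = linf_sum (\<lambda>_. Ext (unit_ball_of W))"
    using Ext_unit_ball_linear_isometry(1)[OF f f_norm]
    by (simp add: f_range Y_def unit_ball_of_linf_sum Ext_linf_sum)
  have inj_f: "inj f" by (rule Ext_unit_ball_linear_isometry(2)[OF f f_norm])
  have finL: "finite (Ext (unit_ball_of (UNIV :: ('x \<Rightarrow>\<^sub>L 'n linf) set)))"
    using finite_linf_sum[of "\<lambda>_. Ext (unit_ball_of W)", OF fin] inj_f
    by (metis image finite_imageD inj_on_subset subset_UNIV)
  have card: "card (Ext (unit_ball_of (UNIV :: ('x \<Rightarrow>\<^sub>L 'n linf) set))) =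
      card (Ext (unit_ball_of W)) ^ CARD('n)"
    using card_image[OF inj_on_subset[OF inj_f subset_UNIV], of "Ext (unit_ball_of UNIV)"]
    by (simp add: image card_linf_sum)
  show ?thesis
    by (intro conjI exI[of _ Y] sub dim iso Y_def finL fin card)
qed

end
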